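(* If a group $G$ is algorithmically stackable, then $G$ has solvable word problem.
   Context: Conventions. A finite generating set $A$ of a group $G$ is symmetric if it is closed under inversion; for $a\in A$, $a^{-1}\in A$ denotes the inverse letter. Standing assumption: no element of $A$ represents the identity of $G$. $A^*$ is the set of words over $A$, and $\rho:A^*\to G$ is the canonical monoid homomorphism. Let $\Gamma=\Gamma(G,A)$ be the Cayley graph, $\vec E$ its set of directed edges, and $\vec P$ its set of directed edge paths; $\lambda:\vec P\to A^*$ maps each path to the word labeling it. For $g\in G$, $a\in A$, let $e_{g,a}\in\vec E$ be the directed edge with initial vertex $g$, terminal vertex $ga$ and label $a$. The directed edges $e_{g,a}$ and $e_{ga,a^{-1}}$ are viewed as having a single underlying undirected edge. The edges lying on a directed path are taken with the direction in which the path traverses them. Flow function. A flow function associated to a maximal tree $T$ in $\Gamma$ is a function $\Phi:\vec E\to\vec P$ such that: (F1) for each $e\in\vec E$, the path $\Phi(e)$ has the same initial and terminal vertices as $e$; (F2d) if the undirected edge underlying $e$ lies in $T$, then $\Phi(e)=e$; (F2r) the transitive closure $<_\Phi$ of the relation $<$ on $\vec E$ defined by "$e'<e$ whenever $e'$ lies on the path $\Phi(e)$ and the undirected edges underlying both $e$ and $e'$ do not lie in $T$" is a well-founded strict partial ordering. A flow function is bounded if there is a constant $k$ such that for all $e\in\vec E$ the path $\Phi(e)$ has length at most $k$. Algorithmically stackable. $G$ is algorithmically stackable if for some finite symmetric generating set $A$ there is a bounded flow function $\Phi$ on $\Gamma(G,A)$ (associated to some maximal tree) such that the subset $$S_\Phi:=\{(w,a,\lambda(\Phi(e_{\rho(w),a})))\mid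 w\in A^*,\ a\in A\}$$ of $A^*\times A\times A^*$ is recursive (computable). *)

theory Defs
  imports
    "HOL-Algebra.Generated_Groups"
    "HOL-Library.Countable_Set"
    "HOL-Library.Nat_Bijection"
    "Graph_Theory.Digraph_Component"
begin

section \<open>Recursive sets\<close>

text \<open>
  Kleene's partial recursive functions: descriptions \<open>recf\<close> together with their input/output
  relation. \<open>Zero\<close> and \<open>Proj\<close> are used at every arity. Primitive recursion is on the first
  argument, and \<open>Mu f\<close> searches for the least value of the first argument at which \<open>f\<close> vanishes,
  requiring \<open>f\<close> to be defined at all smaller values. No output is related to an input at which
  the function is undefined.
\<close>

datatype recf =
    Zero
  | Succ
  | Proj nat
  | Comp recf "recf list"
  | PrimRec recf recf
  | Mu recf

inductive computes :: "recf \<Rightarrow> nat list \<Rightarrow> nat \<Rightarrow> bool" where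
  Zero: "computes Zero xs 0"
| Succ: "computes Succ [x] (Suc x)"
| Proj: "i < length xs \<Longrightarrow> computes (Proj i) xs (xs ! i)"
| Comp: "\<lbrakk>length ys = length gs; \<forall>i<length gs. computes (gs ! i) xs (ys ! i); computes f ys z\<rbrakk>
         \<Longrightarrow> computes (Comp f gs) xs z"
| PrimRec_0: "computes f xs y \<Longrightarrow> computes (PrimRec f g) (0 # xs) y"
| PrimRec_Suc: "\<lbrakk>computes (PrimRec f g) (n # xs) y; computes g (n # y # xs) z\<rbrakk>
         \<Longrightarrow> computes (PrimRec f g) (Suc n # xs) z"
| Mu: "\<lbrakk>computes f (n # xs) 0; \<forall>m<n. \<exists>y>0. computes f (m # xs) y\<rbrakk>
         \<Longrightarrow> computes (Mu f) xs n"

text \<open>The relation is single-valued, so \<open>computes f\<close> is indeed a partial function.\<close>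

inductive_cases computes_ZeroE: "computes Zero xs z"
inductive_cases computes_SuccE: "computes Succ xs z"
inductive_cases computes_ProjE: "computes (Proj i) xs z"
inductive_cases computes_CompE: "computes (Comp f gs) xs z"
inductive_cases computes_PrimRec_0E: "computes (PrimRec f g) (0 # xs) z"
inductive_cases computes_PrimRec_SucE: "computes (PrimRec f g) (Suc n # xs) z"
inductive_cases computes_MuE: "computes (Mu f) xs z"

lemma computes_functional:
  assumes "computes f xs y" "computes f xs z"
  shows "y = z"
  using assms
proof (induction arbitrary: z rule: computes.induct)
  case (Zero xs)
  then show ?case by (rule computes_ZeroE) simp
next
  case (Succ x)
  then show ?case by (rule computes_SuccE) simp
next
  case (Proj i xs)
  from Proj(2) show ?case by (rule computes_ProjE) simp
next
  case (Comp ys gs xs f z')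
  from Comp.prems obtain ys' where ys': "length ys' = length gs"
      "\<forall>i<length gs. computes (gs ! i) xs (ys' ! i)" "computes f ys' z"
    by (rule computes_CompE)
  have "ys = ys'"
    using Comp.IH(1) Comp.hyps ys'(1,2) by (intro nth_equalityI) simp_all
  with Comp.IH(2) ys'(3) show ?case by blast
next
  case (PrimRec_0 f xs y g)
  from PrimRec_0.prems have "computes f xs z" by (rule computes_PrimRec_0E)
  with PrimRec_0.IH show ?case by blast
next
  case (PrimRec_Suc f g n xs y z')
  from PrimRec_Suc.prems obtain y' where "computes (PrimRec f g) (n # xs) y'"
      "computes g (n # y' # xs) z"
    by (rule computes_PrimRec_SucE)
  with PrimRec_Suc.IH show ?case by blast
next
  case (Mu f n xs)
  from Mu.prems have z: "computes f (z # xs) 0" "\<forall>m<z. \<exists>y>0. computes f (m # xs) y"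
    by - (erule computes_MuE, assumption)+
  show ?case
  proof (cases n z rule: linorder_cases)
    case less
    with z(2) obtain y where "y > 0" "computes f (n # xs) y" by blast
    with Mu.IH(1) show ?thesis by blast
  next
    case greater
    with Mu.IH(2) z(1) show ?thesis by blast
  qed
qed

definition recursive_set :: "nat set \<Rightarrow> bool" where
  "recursive_set X \<longleftrightarrow> (\<exists>f. \<forall>n. computes f [n] (if n \<in> X then 1 else 0))"

text \<open>
  Goedel numbering of words over a finite alphabet \<open>A\<close>. The letters are numbered by the library
  bijection \<open>to_nat_on A\<close> from \<open>A\<close> to \<open>{..<card A}\<close>; since \<open>A\<close> is finite, any two numberings of
  the letters differ by a recursive recoding, so that the choice does not affect recursiveness.
\<close>

definition word_code :: "'a set \<Rightarrow> 'a list \<Rightarrow> nat" where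
  "word_code A w = list_encode (map (to_nat_on A) w)"

definition triple_code :: "'a set \<Rightarrow> 'a list \<times> 'a \<times> 'a list \<Rightarrow> nat" where
  "triple_code A = (\<lambda>(w, a, v).
     prod_encode (word_code A w, prod_encode (to_nat_on A a, word_code A v)))"


section \<open>Cayley graphs\<close>

definition finite_symmetric_generating_set :: "('a, 'm) monoid_scheme \<Rightarrow> 'a set \<Rightarrow> bool" where
  "finite_symmetric_generating_set G A \<longleftrightarrow>
     finite A \<and> A \<subseteq> carrier G \<and> generate G A = carrier G \<and>
     (\<forall>a\<in>A. inv\<^bsub>G\<^esub> a \<in> A) \<and> \<one>\<^bsub>G\<^esub> \<notin> A"

definition word_value :: "('a, 'm) monoid_scheme \<Rightarrow> 'a list \<Rightarrow> 'a" where
  "word_value G w = foldr (\<otimes>\<^bsub>G\<^esub>) w \<one>\<^bsub>G\<^esub>"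

text \<open>The directed edge from \<open>g\<close> to \<open>g \<otimes> a\<close> with label \<open>a\<close> is the pair \<open>(g, a)\<close>.\<close>

definition cayley_graph :: "('a, 'm) monoid_scheme \<Rightarrow> 'a set \<Rightarrow> ('a, 'a \<times> 'a) pre_digraph" where
  "cayley_graph G A =
     \<lparr>verts = carrier G, arcs = carrier G \<times> A, tail = fst, head = (\<lambda>(g, a). g \<otimes>\<^bsub>G\<^esub> a)\<rparr>"

definition edge_inv :: "('a, 'm) monoid_scheme \<Rightarrow> 'a \<times> 'a \<Rightarrow> 'a \<times> 'a" where
  "edge_inv G = (\<lambda>(g, a). (g \<otimes>\<^bsub>G\<^esub> a, inv\<^bsub>G\<^esub> a))"

definition underlying_edge :: "('a, 'm) monoid_scheme \<Rightarrow> 'a \<times> 'a \<Rightarrow> ('a \<times> 'a) set" where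
  "underlying_edge G e = {e, edge_inv G e}"

definition path_label :: "('a \<times> 'a) list \<Rightarrow> 'a list" where
  "path_label p = map snd p"

text \<open>
  A subgraph of the underlying undirected graph is given by a subdigraph closed under inverting
  edges, so that an undirected edge lies in it iff either (equivalently, both) of its orientations
  is an arc. The predicate \<open>tree\<close> of \<open>Graph_Theory\<close> does not apply to such digraphs, because it
  regards the path \<open>[e, edge_inv G e]\<close> as a cycle; a cycle of the undirected graph has to be a
  directed cycle in which no undirected edge is repeated.
\<close>

definition undirected_tree ::
    "('a, 'm) monoid_scheme \<Rightarrow> ('a, 'a \<times> 'a) pre_digraph \<Rightarrow> bool" where
  "undirected_tree G T \<longleftrightarrow>
     (\<forall>e\<in>arcs T. edge_inv G e \<in> arcs T) \<and> connected T \<and>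
     \<not> (\<exists>p. pre_digraph.cycle T p \<and> distinct (map (underlying_edge G) p))"

definition maximal_tree ::
    "('a, 'm) monoid_scheme \<Rightarrow> 'a set \<Rightarrow> ('a, 'a \<times> 'a) pre_digraph \<Rightarrow> bool" where
  "maximal_tree G A T \<longleftrightarrow> pre_digraph.max_subgraph (cayley_graph G A) (undirected_tree G) T"


section \<open>Flow functions and stackability\<close>

definition flow_less ::
    "('a, 'm) monoid_scheme \<Rightarrow> 'a set \<Rightarrow> ('a, 'a \<times> 'a) pre_digraph
     \<Rightarrow> ('a \<times> 'a \<Rightarrow> ('a \<times> 'a) list) \<Rightarrow> (('a \<times> 'a) \<times> ('a \<times> 'a)) set" where
  "flow_less G A T \<Phi> =
     {(e', e). e \<in> arcs (cayley_graph G A) \<and> e' \<in> arcs (cayley_graph G A) \<and>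
               e' \<in> set (\<Phi> e) \<and> e \<notin> arcs T \<and> e' \<notin> arcs T}\<^sup>+"

definition flow_function ::
    "('a, 'm) monoid_scheme \<Rightarrow> 'a set \<Rightarrow> ('a, 'a \<times> 'a) pre_digraph
     \<Rightarrow> ('a \<times> 'a \<Rightarrow> ('a \<times> 'a) list) \<Rightarrow> bool" where
  "flow_function G A T \<Phi> \<longleftrightarrow>
     (let \<Gamma> = cayley_graph G A in
        (\<forall>e\<in>arcs \<Gamma>. pre_digraph.awalk \<Gamma> (tail \<Gamma> e) (\<Phi> e) (head \<Gamma> e)) \<and>
        (\<forall>e\<in>arcs \<Gamma>. e \<in> arcs T \<longrightarrow> \<Phi> e = [e])) \<and>
     irrefl (flow_less G A T \<Phi>) \<and> trans (flow_less G A T \<Phi>) \<and> wf (flow_less G A T \<Phi>)"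

definition bounded_flow ::
    "('a, 'm) monoid_scheme \<Rightarrow> 'a set \<Rightarrow> ('a \<times> 'a \<Rightarrow> ('a \<times> 'a) list) \<Rightarrow> bool" where
  "bounded_flow G A \<Phi> \<longleftrightarrow> (\<exists>k. \<forall>e\<in>arcs (cayley_graph G A). length (\<Phi> e) \<le> k)"

definition flow_graph_set ::
    "('a, 'm) monoid_scheme \<Rightarrow> 'a set \<Rightarrow> ('a \<times> 'a \<Rightarrow> ('a \<times> 'a) list)
     \<Rightarrow> ('a list \<times> 'a \<times> 'a list) set" where
  "flow_graph_set G A \<Phi> =
     {(w, a, path_label (\<Phi> (word_value G w, a))) | w a. w \<in> lists A \<and> a \<in> A}"

definition algorithmically_stackable :: "('a, 'm) monoid_scheme \<Rightarrow> bool" where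
  "algorithmically_stackable G \<longleftrightarrow>
     (\<exists>A T \<Phi>. finite_symmetric_generating_set G A \<and> maximal_tree G A T \<and>
        flow_function G A T \<Phi> \<and> bounded_flow G A \<Phi> \<and>
        recursive_set (triple_code A ` flow_graph_set G A \<Phi>))"

text \<open>
  Solvability of the word problem does not depend on the finite symmetric generating set. The
  definition requires it for all of them, the first conjunct saying that there is one.
\<close>

definition solvable_word_problem :: "('a, 'm) monoid_scheme \<Rightarrow> bool" where
  "solvable_word_problem G \<longleftrightarrow>
     (\<exists>A. finite_symmetric_generating_set G A) \<and>
     (\<forall>A. finite_symmetric_generating_set G A \<longrightarrow>
        recursive_set (word_code A ` {w \<in> lists A. word_value G w = \<one>\<^bsub>G\<^esub>}))"

end

theory Submission
  imports Defs
begin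

text \<open>
  The word problem is decided by rewriting with the flow function. A word is read from left to
  right by a machine whose stack holds a word already known to trace out, from the identity, a
  path in the tree without backtracking. Faced with a next letter \<open>a\<close>, the machine pops the top of
  the stack if \<open>a\<close> cancels it. Otherwise it looks at the edge \<open>e\<close> labelled \<open>a\<close> at the end of the
  path: if \<open>e\<close> lies in the tree then \<open>a\<close> is pushed, and if not then \<open>a\<close> is replaced in the input
  by the label of \<open>\<Phi> e\<close>. Every move preserves the group element represented by stack and input
  together.

  The machine halts, because the edges outside the tree that lie on \<open>\<Phi> e\<close> are smaller than \<open>e\<close>
  in a well-founded order: well-founded induction on \<open>e\<close> shows that each single letter is consumed
  after finitely many moves (\<open>reads_letter\<close>). When the input is exhausted, the stack is a reduced
  word for the given element, and its path stays in the tree. A tree has no reduced closed path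
  other than the trivial one (\<open>reduced_closed_tree_path_trivial\<close>), so the given word represents
  the identity iff the final stack is empty (\<open>step_decides_word_problem\<close>).

  The moves are computable because the graph of the map from a stack and a letter to the label of
  the flow path is recursive. The flow is bounded, so this map has only finitely many values, and
  its value is found by testing each of them (\<open>computable_finite_values\<close>). Being in the tree is
  decidable as well: exactly the edges of the tree have a flow path labelled by their own single
  letter, since an edge outside the tree on its own flow path would lie below itself. The number
  of moves has no bound known beforehand, and unbounded search supplies it. Finally, a word over
  another finite symmetric generating set is translated letter by letter by means of a finite table.

  To write these algorithms as partial recursive functions, coded types are introduced together
  with closure properties of the computable functions between them. Reversing, concatenating and
  translating words are then folds over lists.
\<close>

section \<open>Partial recursive functions on numbers\<close>

lemma computes_Comp1:
  "computes g xs a \<Longrightarrow> computes f [a] z \<Longrightarrow> computes (Comp f [g]) xs z"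
  by (rule computes.Comp[of "[a]"]) auto

lemma computes_Comp2:
  "computes g xs a \<Longrightarrow> computes h xs b \<Longrightarrow> computes f [a, b] z \<Longrightarrow> computes (Comp f [g, h]) xs z"
  by (rule computes.Comp[of "[a, b]"]) (auto simp: less_Suc_eq)

lemma computes_Comp3:
  "computes g xs a \<Longrightarrow> computes h xs b \<Longrightarrow> computes k xs c \<Longrightarrow> computes f [a, b, c] z
   \<Longrightarrow> computes (Comp f [g, h, k]) xs z"
  by (rule computes.Comp[of "[a, b, c]"]) (auto simp: less_Suc_eq numeral_eq_Suc)

lemma computes_Proj: "i < length xs \<Longrightarrow> y = xs ! i \<Longrightarrow> computes (Proj i) xs y"
  by (simp add: computes.Proj)

primrec recf_const :: "nat \<Rightarrow> recf" where
  "recf_const 0 = Zero"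
| "recf_const (Suc n) = Comp Succ [recf_const n]"

lemma computes_const: "computes (recf_const n) xs n"
  by (induction n) (auto intro: computes.Zero computes.Succ computes_Comp1)

definition recf_add :: recf where
  "recf_add = PrimRec (Proj 0) (Comp Succ [Proj 1])"

lemma computes_add: "computes recf_add [m, n] (m + n)"
proof (induction m)
  case 0
  show ?case unfolding recf_add_def by (rule computes.PrimRec_0) (simp add: computes_Proj)
next
  case (Suc m)
  have "computes (Comp Succ [Proj 1]) [m, m + n, n] (Suc m + n)"
    by (rule computes_Comp1[where a = "m + n"]) (simp_all add: computes_Proj computes.Succ)
  with Suc show ?case unfolding recf_add_def by (rule computes.PrimRec_Suc)
qed

definition recf_pred :: recf where
  "recf_pred = PrimRec Zero (Proj 0)"

lemma computes_pred: "computes recf_pred [n] (n - 1)"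
proof (induction n)
  case 0
  show ?case unfolding recf_pred_def by (rule computes.PrimRec_0) (simp add: computes.Zero)
next
  case (Suc n)
  have "computes (Proj 0) [n, n - 1] (Suc n - 1)" by (simp add: computes_Proj)
  with Suc show ?case unfolding recf_pred_def by (rule computes.PrimRec_Suc)
qed

text \<open>Primitive recursion runs on the first argument, so the subtrahend comes first.\<close>

definition recf_diff :: recf where
  "recf_diff = PrimRec (Proj 0) (Comp recf_pred [Proj 1])"

lemma computes_diff: "computes recf_diff [m, n] (n - m)"
proof (induction m)
  case 0
  show ?case unfolding recf_diff_def by (rule computes.PrimRec_0) (simp add: computes_Proj)
next
  case (Suc m)
  have "computes (Comp recf_pred [Proj 1]) [m, n - m, n] (n - m - 1)"
    by (rule computes_Comp1[OF _ computes_pred]) (simp add: computes_Proj)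
  with Suc show ?case unfolding recf_diff_def by (auto intro: computes.PrimRec_Suc)
qed

definition recf_triangle :: recf where
  "recf_triangle = PrimRec Zero (Comp recf_add [Comp Succ [Proj 0], Proj 1])"

lemma computes_triangle: "computes recf_triangle [n] (triangle n)"
proof (induction n)
  case 0
  show ?case unfolding recf_triangle_def by (auto intro: computes.PrimRec_0 computes.Zero)
next
  case (Suc n)
  have "computes (Comp Succ [Proj 0]) [n, triangle n] (Suc n)"
    by (rule computes_Comp1[where a = n]) (simp_all add: computes_Proj computes.Succ)
  moreover have "computes (Proj 1) [n, triangle n] (triangle n)" by (simp add: computes_Proj)
  ultimately have "computes (Comp recf_add [Comp Succ [Proj 0], Proj 1]) [n, triangle n]
      (Suc n + triangle n)"
    using computes_add by (rule computes_Comp2)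
  with Suc show ?case unfolding recf_triangle_def
    by (auto intro: computes.PrimRec_Suc simp: add.commute)
qed

definition recf_cond :: recf where
  "recf_cond = PrimRec (Proj 1) (Proj 2)"

lemma computes_cond: "computes recf_cond [c, x, y] (if c = 0 then y else x)"
proof (induction c)
  case 0
  show ?case unfolding recf_cond_def by (rule computes.PrimRec_0) (simp add: computes_Proj)
next
  case (Suc c)
  have "computes (Proj 2) [c, if c = 0 then y else x, x, y] x" by (simp add: computes_Proj)
  with Suc show ?case unfolding recf_cond_def by (auto intro: computes.PrimRec_Suc)
qed

lemma computes_Mu:
  assumes "\<And>m. m \<le> n \<Longrightarrow> computes f (m # xs) (F m)" "F n = 0" "\<And>m. m < n \<Longrightarrow> F m > 0"
  shows "computes (Mu f) xs n"
proof (rule computes.Mu)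
  show "computes f (n # xs) 0" using assms(1)[of n] assms(2) by simp
  show "\<forall>m<n. \<exists>y>0. computes f (m # xs) y"
    using assms(1,3) by (meson less_imp_le)
qed

definition recf_pair :: recf where
  "recf_pair = Comp recf_add [Comp recf_triangle [recf_add], Proj 0]"

lemma computes_pair: "computes recf_pair [m, n] (prod_encode (m, n))"
  unfolding recf_pair_def prod_encode_def prod.case
  by (intro computes_Comp2[OF _ _ computes_add] computes_Comp1[OF _ computes_triangle]
      computes_add computes_Proj) simp_all

text \<open>
  The code of a pair with sum \<open>s\<close> is at least the \<open>s\<close>-th triangular number and less than the
  next one, so that searching for the least such \<open>s\<close> recovers the sum.
\<close>

definition recf_pair_sum :: recf where
  "recf_pair_sum =
     Mu (Comp recf_diff [Comp recf_triangle [Comp Succ [Proj 0]], Comp Succ [Proj 1]])"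

lemma triangle_mono: "m \<le> n \<Longrightarrow> triangle m \<le> triangle n"
  by (induction n rule: dec_induct) auto

lemma computes_pair_sum: "computes recf_pair_sum [prod_encode (m, n)] (m + n)"
  unfolding recf_pair_sum_def
proof (rule computes_Mu[where F = "\<lambda>s. Suc (prod_encode (m, n)) - triangle (Suc s)"])
  fix s
  show "computes (Comp recf_diff [Comp recf_triangle [Comp Succ [Proj 0]], Comp Succ [Proj 1]])
          [s, prod_encode (m, n)] (Suc (prod_encode (m, n)) - triangle (Suc s))"
    by (rule computes_Comp2[OF _ _ computes_diff] computes_Comp1[OF _ computes_triangle]
        computes_Comp1[OF _ computes.Succ] computes_Proj | simp)+
next
  show "Suc (prod_encode (m, n)) - triangle (Suc (m + n)) = 0"
    by (simp add: prod_encode_def)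
next
  fix s assume "s < m + n"
  then have "triangle (Suc s) \<le> triangle (m + n)" by (intro triangle_mono) simp
  then show "Suc (prod_encode (m, n)) - triangle (Suc s) > 0"
    unfolding prod_encode_def prod.case by linarith
qed

definition recf_fst :: recf where
  "recf_fst = Comp recf_diff [Comp recf_triangle [recf_pair_sum], Proj 0]"

lemma computes_fst: "computes recf_fst [prod_encode (m, n)] m"
proof -
  have "computes recf_fst [prod_encode (m, n)] (prod_encode (m, n) - triangle (m + n))"
    unfolding recf_fst_def
    by (rule computes_Comp2[OF _ _ computes_diff] computes_Comp1[OF _ computes_triangle]
        computes_pair_sum computes_Proj | simp)+
  then show ?thesis by (simp add: prod_encode_def)
qed

definition recf_snd :: recf where
  "recf_snd = Comp recf_diff [recf_fst, recf_pair_sum]"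

lemma computes_snd: "computes recf_snd [prod_encode (m, n)] n"
proof -
  have "computes recf_snd [prod_encode (m, n)] (m + n - m)"
    unfolding recf_snd_def
    by (rule computes_Comp2[OF computes_fst computes_pair_sum computes_diff])
  then show ?thesis by simp
qed


section \<open>Computable functions between coded types\<close>

text \<open>
  Pairs and lists are coded as in \<^const>\<open>triple_code\<close> and \<^const>\<open>word_code\<close>, so that recursive sets
  of codes of words are exactly the computable predicates on lists of numbers.
\<close>

class coded =
  fixes encode :: "'a \<Rightarrow> nat"
  assumes inj_encode: "inj encode"

lemma encode_eq_iff [simp]: "encode x = encode y \<longleftrightarrow> x = y"
  by (rule inj_eq[OF inj_encode])

instantiation nat :: coded
begin
definition encode_nat :: "nat \<Rightarrow> nat" where [simp]: "encode_nat n = n"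
instance by standard (simp add: inj_def)
end

instantiation bool :: coded
begin
definition encode_bool :: "bool \<Rightarrow> nat" where [simp]: "encode_bool b = (if b then 1 else 0)"
instance by standard (simp add: inj_def)
end

instantiation prod :: (coded, coded) coded
begin
definition encode_prod :: "'a \<times> 'b \<Rightarrow> nat" where
  [simp]: "encode_prod p = prod_encode (encode (fst p), encode (snd p))"
instance by standard (simp add: inj_def prod_eq_iff)
end

instantiation list :: (coded) coded
begin
definition encode_list :: "'a list \<Rightarrow> nat" where
  [simp]: "encode_list xs = list_encode (map encode xs)"
instance by standard (simp add: inj_def list_encode_eq inj_map_eq_map inj_encode)
end

definition computable :: "('a::coded \<Rightarrow> 'b::coded) \<Rightarrow> bool" where
  "computable f \<longleftrightarrow> (\<exists>r. \<forall>x. computes r [encode x] (encode (f x)))"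

lemma computableE:
  assumes "computable f"
  obtains r where "\<And>x. computes r [encode x] (encode (f x))"
  using assms unfolding computable_def by blast

lemma computableI:
  assumes "\<And>x. computes r [encode x] (encode (f x))"
  shows "computable f"
  using assms unfolding computable_def by blast

named_theorems computable_intros

lemma computable_compose:
  assumes "computable f" "computable g"
  shows "computable (\<lambda>x. f (g x))"
proof -
  obtain r s where "\<And>y. computes r [encode y] (encode (f y))"
    "\<And>x. computes s [encode x] (encode (g x))"
    using assms by (elim computableE) blast
  then show ?thesis by (intro computableI[of "Comp r [s]"] computes_Comp1)
qed

lemma computable_id [computable_intros]: "computable (\<lambda>x. x)"
  by (rule computableI[of "Proj 0"]) (simp add: computes_Proj)

lemma computable_const [computable_intros]: "computable (\<lambda>x. c)"
  by (rule computableI) (rule computes_const)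

lemma computable_fst [computable_intros]: "computable f \<Longrightarrow> computable (\<lambda>x. fst (f x))"
  by (rule computable_compose[of fst], rule computableI[of recf_fst]) (simp_all add: computes_fst)

lemma computable_snd [computable_intros]: "computable f \<Longrightarrow> computable (\<lambda>x. snd (f x))"
  by (rule computable_compose[of snd], rule computableI[of recf_snd]) (simp_all add: computes_snd)

lemma computable_Pair [computable_intros]:
  assumes "computable f" "computable g"
  shows "computable (\<lambda>x. (f x, g x))"
proof -
  obtain r s where "\<And>x. computes r [encode x] (encode (f x))"
    "\<And>x. computes s [encode x] (encode (g x))"
    using assms by (elim computableE) blast
  then show ?thesis
    by (intro computableI[of "Comp recf_pair [r, s]"])
       (simp add: computes_Comp2[OF _ _ computes_pair])
qed

text \<open>
  A function of two arguments counts as computable if its version on pairs is; this turns that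
  version back into a closure property.
\<close>

lemma computable_curried:
  assumes "computable (\<lambda>p. F (fst p) (snd p))" "computable f" "computable g"
  shows "computable (\<lambda>x. F (f x) (g x))"
  using computable_compose[OF assms(1) computable_Pair[OF assms(2,3)]] by simp

text \<open>
  Both branches are evaluated and the result is then selected. This is harmless because a recursive
  description of a computable function is defined at all codes of its arguments.
\<close>

lemma computable_If [computable_intros]:
  assumes "computable P" "computable f" "computable g"
  shows "computable (\<lambda>x. if P x then f x else g x)"
proof -
  obtain p r s where "\<And>x. computes p [encode x] (encode (P x))"
    "\<And>x. computes r [encode x] (encode (f x))" "\<And>x. computes s [encode x] (encode (g x))"
    using assms by (elim computableE) blast
  then have "computes (Comp recf_cond [p, r, s]) [encode x]
      (if encode (P x) = 0 then encode (g x) else encode (f x))" for x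
    by (intro computes_Comp3[OF _ _ _ computes_cond])
  moreover have "(if encode (P x) = 0 then encode (g x) else encode (f x)) =
      encode (if P x then f x else g x)" for x
    by simp
  ultimately show ?thesis by (simp only:) (rule computableI)
qed

lemma computable_conj [computable_intros]:
  assumes "computable P" "computable Q"
  shows "computable (\<lambda>x. P x \<and> Q x)"
proof -
  have "(\<lambda>x. P x \<and> Q x) = (\<lambda>x. if P x then Q x else False)" by auto
  then show ?thesis by (simp only:) (intro computable_intros assms)
qed

lemma computable_Not [computable_intros]:
  assumes "computable P"
  shows "computable (\<lambda>x. \<not> P x)"
proof -
  have "(\<lambda>x. \<not> P x) = (\<lambda>x. if P x then False else True)" by auto
  then show ?thesis by (simp only:) (intro computable_intros assms)
qed

text \<open>Two numbers are equal iff both truncated differences vanish.\<close>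

lemma computable_eq [computable_intros]:
  assumes "computable f" "computable g"
  shows "computable (\<lambda>x. f x = g x)"
proof -
  obtain r s where rs: "\<And>x. computes r [encode x] (encode (f x))"
    "\<And>x. computes s [encode x] (encode (g x))"
    using assms by (elim computableE) blast
  define d where "d x = (encode (g x) - encode (f x)) + (encode (f x) - encode (g x))" for x
  have "computes (Comp recf_add [Comp recf_diff [r, s], Comp recf_diff [s, r]]) [encode x] (d x)"
    for x
    unfolding d_def
    by (intro computes_Comp2[OF _ _ computes_add] computes_Comp2[OF _ _ computes_diff] rs)
  then have "computes (Comp recf_diff
      [Comp recf_add [Comp recf_diff [r, s], Comp recf_diff [s, r]], recf_const 1]) [encode x]
      (1 - d x)" for x
    by (intro computes_Comp2[OF _ _ computes_diff] computes_const)
  moreover have "1 - d x = encode (f x = g x)" for x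
  proof (cases "f x = g x")
    case False
    then have "encode (f x) \<noteq> encode (g x)" by simp
    then have "d x > 0" unfolding d_def by linarith
    with False show ?thesis by simp
  qed (simp add: d_def)
  ultimately show ?thesis by (simp only:) (rule computableI)
qed

lemma computable_Cons [computable_intros]:
  assumes "computable f" "computable g"
  shows "computable (\<lambda>x. f x # g x)"
proof -
  obtain r where "\<And>x. computes r [encode x] (encode (f x, g x))"
    using computable_Pair[OF assms] by (elim computableE) blast
  then have "computes (Comp Succ [r]) [encode x] (encode (f x # g x))" for x
    using computes_Comp1[OF _ computes.Succ] by fastforce
  then show ?thesis by (rule computableI)
qed

text \<open>The value at the empty list is an unspecified constant, which is as computable as any other.\<close>

lemma computable_hd [computable_intros]:
  fixes f :: "'a::coded \<Rightarrow> 'b::coded list"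
  assumes "computable f"
  shows "computable (\<lambda>x. hd (f x))"
proof (rule computable_compose[OF _ assms])
  let ?r = "Comp recf_cond [Proj 0, Comp recf_fst [recf_pred], recf_const (encode (hd [] :: 'b))]"
  have "computes ?r [encode xs] (encode (hd xs))" for xs :: "'b list"
  proof -
    let ?c = "encode xs"
    have "computes (Comp recf_fst [recf_pred]) [?c] (fst (prod_decode (?c - 1)))"
      using computes_fst[of "fst (prod_decode (?c - 1))" "snd (prod_decode (?c - 1))"]
      by (intro computes_Comp1[OF computes_pred]) simp
    then have "computes ?r [?c]
        (if ?c = 0 then encode (hd [] :: 'b) else fst (prod_decode (?c - 1)))"
      by (intro computes_Comp3[OF _ _ _ computes_cond] computes_const computes_Proj) auto
    then show ?thesis by (cases xs) simp_all
  qed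
  then show "computable (hd :: 'b list \<Rightarrow> 'b)" by (rule computableI)
qed

lemma computable_tl [computable_intros]:
  fixes f :: "'a::coded \<Rightarrow> 'b::coded list"
  assumes "computable f"
  shows "computable (\<lambda>x. tl (f x))"
proof (rule computable_compose[OF _ assms])
  let ?r = "Comp recf_snd [recf_pred]"
  have "computes ?r [encode xs] (encode (tl xs))" for xs :: "'b list"
  proof -
    let ?c = "encode xs"
    have "computes ?r [?c] (snd (prod_decode (?c - 1)))"
      using computes_snd[of "fst (prod_decode (?c - 1))" "snd (prod_decode (?c - 1))"]
      by (intro computes_Comp1[OF computes_pred]) simp
    moreover have "snd (prod_decode 0) = 0"
      using prod_encode_inverse[of "(0, 0)"] by (simp add: prod_encode_def)
    ultimately show ?thesis by (cases xs) simp_all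
  qed
  then show "computable (tl :: 'b list \<Rightarrow> 'b list)" by (rule computableI)
qed

lemma computable_funpow:
  fixes F :: "'b::coded \<Rightarrow> 'b"
  assumes F: "computable F" and "computable n" "computable s"
  shows "computable (\<lambda>x. (F ^^ n x) (s x))"
proof -
  obtain r t u where r: "\<And>x. computes r [encode x] (encode (F x))"
    and t: "\<And>x. computes t [encode x] (encode (n x))"
    and u: "\<And>x. computes u [encode x] (encode (s x))"
    using assms by (elim computableE) blast
  let ?p = "PrimRec (Proj 0) (Comp r [Proj 1])"
  have p: "computes ?p [k, encode y] (encode ((F ^^ k) y))" for k y
  proof (induction k)
    case 0
    show ?case by (rule computes.PrimRec_0, rule computes_Proj) simp_all
  next
    case (Suc k)
    have "computes (Comp r [Proj 1]) [k, encode ((F ^^ k) y), encode y]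
        (encode (F ((F ^^ k) y)))"
      by (rule computes_Comp1[OF _ r]) (simp add: computes_Proj)
    with Suc show ?case by (auto intro: computes.PrimRec_Suc)
  qed
  have "computes (Comp ?p [t, u]) [encode x] (encode ((F ^^ n x) (s x)))" for x
    using computes_Comp2[OF t u p] t by simp
  then show ?thesis by (rule computableI)
qed

lemma length_le_encode: "length xs \<le> encode xs"
  by (induction xs) (auto intro: order_trans[OF _ le_prod_encode_2])

text \<open>
  A fold consumes one letter per iteration, and may idle once the list is empty. Hence it suffices
  to iterate as often as the code of the list says.
\<close>

lemma computable_foldl:
  fixes F :: "'s::coded \<Rightarrow> 'b::coded \<Rightarrow> 's"
  assumes F: "computable (\<lambda>p. F (fst p) (snd p))" and s: "computable s" and xs: "computable xs"
  shows "computable (\<lambda>x. foldl F (s x) (xs x))"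
proof -
  define st where "st p = (if snd p = [] then p else (F (fst p) (hd (snd p)), tl (snd p)))" for p
  have "computable st"
    unfolding st_def by (intro computable_intros computable_curried[OF F])
  moreover have "computable (encode :: 'b list \<Rightarrow> nat)"
    by (rule computableI[of "Proj 0"]) (simp add: computes_Proj)
  ultimately have iterate: "computable (\<lambda>x. fst ((st ^^ encode (xs x)) (s x, xs x)))"
    by (intro computable_fst computable_funpow computable_Pair s xs
        computable_compose[of encode xs])
  have st: "(st ^^ n) (b, ys) = (foldl F b ys, [])" if "length ys \<le> n" for n b ys
    using that
  proof (induction n arbitrary: b ys)
    case (Suc n)
    show ?case
    proof (cases ys)
      case Nil
      with Suc.IH[of "[]" b] show ?thesis by (simp add: st_def)
    next
      case (Cons y zs)
      with Suc show ?thesis by (simp add: funpow_Suc_right st_def del: funpow.simps)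
    qed
  qed simp
  then have "fst ((st ^^ encode (xs x)) (s x, xs x)) = foldl F (s x) (xs x)" for x
    by (simp only: st[OF length_le_encode] fst_conv)
  with iterate show ?thesis by (simp only:)
qed

lemma foldl_Cons_eq_rev_append: "foldl (\<lambda>zs y. y # zs) zs ys = rev ys @ zs"
  by (induction ys arbitrary: zs) auto

lemma computable_rev [computable_intros]:
  assumes "computable f"
  shows "computable (\<lambda>x. rev (f x))"
proof -
  have "(\<lambda>x. rev (f x)) = (\<lambda>x. foldl (\<lambda>zs y. y # zs) [] (f x))"
    by (simp add: foldl_Cons_eq_rev_append)
  then show ?thesis by (simp only:) (intro computable_foldl computable_intros assms)
qed

lemma computable_append [computable_intros]:
  assumes "computable f" "computable g"
  shows "computable (\<lambda>x. f x @ g x)"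
proof -
  have "(\<lambda>x. f x @ g x) = (\<lambda>x. foldl (\<lambda>zs y. y # zs) (g x) (rev (f x)))"
    by (simp add: foldl_Cons_eq_rev_append)
  then show ?thesis by (simp only:) (intro computable_foldl computable_intros assms)
qed

lemma computable_concat_map:
  assumes "computable h" "computable f"
  shows "computable (\<lambda>x. concat (map h (f x)))"
proof -
  have "foldl (\<lambda>zs y. zs @ h y) zs ys = zs @ concat (map h ys)" for zs ys
    by (induction ys arbitrary: zs) auto
  then have "(\<lambda>x. concat (map h (f x))) = (\<lambda>x. foldl (\<lambda>zs y. zs @ h y) [] (f x))" by simp
  then show ?thesis
    by (simp only:)
       (intro computable_foldl computable_intros assms(2) computable_compose[OF assms(1)])
qed

lemma computable_list_all:
  assumes "computable P" "computable f"
  shows "computable (\<lambda>x. list_all P (f x))"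
proof -
  have "foldl (\<lambda>b y. b \<and> P y) b ys = (b \<and> list_all P ys)" for b ys
    by (induction ys arbitrary: b) auto
  then have "(\<lambda>x. list_all P (f x)) = (\<lambda>x. foldl (\<lambda>b y. b \<and> P y) True (f x))" by simp
  then show ?thesis
    by (simp only:)
       (intro computable_foldl computable_intros assms(2) computable_compose[OF assms(1)])
qed

text \<open>
  Unbounded search. The assumption that a witness always exists makes the partial function obtained
  by minimisation total.
\<close>

lemma computable_LEAST:
  fixes P :: "nat \<Rightarrow> 'a::coded \<Rightarrow> bool"
  assumes "computable (\<lambda>p. P (fst p) (snd p))" and ex: "\<And>x. \<exists>n. P n x"
  shows "computable (\<lambda>x. LEAST n. P n x)"
proof -
  obtain r where r: "\<And>p. computes r [encode p] (encode (P (fst p) (snd p)))"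
    using assms(1) by (elim computableE) blast
  let ?s = "Comp recf_diff [Comp r [recf_pair], recf_const 1]"
  have "computes ?s [n, encode x] (1 - encode (P n x))" for n x
    using r[of "(n, x)"]
    by (intro computes_Comp2[OF _ _ computes_diff] computes_Comp1[OF computes_pair] computes_const)
       simp
  moreover have "P (LEAST n. P n x) x" for x
    using ex by (rule LeastI_ex)
  ultimately have "computes (Mu ?s) [encode x] (encode (LEAST n. P n x))" for x
    by (simp, intro computes_Mu[where F = "\<lambda>n. 1 - encode (P n x)"])
       (auto dest: not_less_Least)
  then show ?thesis by (rule computableI)
qed

lemma computable_finite_support:
  assumes "finite {x. f x \<noteq> c}"
  shows "computable f"
proof -
  have "computable (\<lambda>x. if x \<in> X then f x else c)" if "finite X" for X
    using that
  proof induction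
    case (insert y X)
    have "(\<lambda>x. if x \<in> insert y X then f x else c) =
        (\<lambda>x. if x = y then f y else if x \<in> X then f x else c)"
      by auto
    then show ?case by (simp only:) (intro computable_intros insert.IH)
  qed (simp add: computable_const)
  moreover have "(\<lambda>x. if x \<in> {x. f x \<noteq> c} then f x else c) = f" by auto
  ultimately show ?thesis using assms by metis
qed

text \<open>
  A function with finitely many values is computable as soon as its graph is decidable. The default
  value \<open>c\<close> is the one taken when all tests fail, so its own fibre need not be tested.
\<close>

lemma computable_finite_values:
  assumes "finite Y" "\<And>y. y \<in> Y \<Longrightarrow> computable (\<lambda>x. f x = y)" "\<And>x. f x \<notin> Y \<Longrightarrow> f x = c"
  shows "computable f"
proof -
  have "computable (\<lambda>x. if f x \<in> Y then f x else c)"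
    using assms(1,2)
  proof induction
    case (insert y Y)
    have "(\<lambda>x. if f x \<in> insert y Y then f x else c) =
        (\<lambda>x. if f x = y then y else if f x \<in> Y then f x else c)"
      by auto
    then show ?case by (simp only:) (intro computable_intros insert.IH insert.prems; simp)
  qed (simp add: computable_const)
  moreover have "(\<lambda>x. if f x \<in> Y then f x else c) = f" using assms(3) by auto
  ultimately show ?thesis by (simp only:)
qed

lemma recursive_set_imp_computable:
  assumes "recursive_set X"
  shows "computable (\<lambda>x::'a::coded. encode x \<in> X)"
proof -
  obtain r where r: "\<And>n. computes r [n] (if n \<in> X then 1 else 0)"
    using assms unfolding recursive_set_def by blast
  show ?thesis
  proof (rule computableI)
    show "computes r [encode x] (encode (encode x \<in> X))" for x :: 'a
      using r[of "encode x"] by (simp only: encode_bool_def)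
  qed
qed

lemma encode_word: "encode (w :: nat list) = list_encode w"
  by (simp add: map_idI)

lemma recursive_set_words_iff:
  fixes X :: "nat list set"
  shows "recursive_set (list_encode ` X) \<longleftrightarrow> computable (\<lambda>w. w \<in> X)"
proof
  assume "recursive_set (list_encode ` X)"
  then have "computable (\<lambda>w::nat list. encode w \<in> list_encode ` X)"
    by (rule recursive_set_imp_computable)
  moreover have "encode w \<in> list_encode ` X \<longleftrightarrow> w \<in> X" for w :: "nat list"
    by (auto simp: encode_word list_encode_eq simp del: encode_list_def)
  ultimately show "computable (\<lambda>w. w \<in> X)" by simp
next
  assume "computable (\<lambda>w. w \<in> X)"
  then obtain r where r: "\<And>w. computes r [encode w] (encode (w \<in> X))"
    unfolding computable_def by blast
  have "computes r [n] (if n \<in> list_encode ` X then 1 else 0)" for n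
  proof -
    have "n \<in> list_encode ` X \<longleftrightarrow> list_decode n \<in> X"
      by (metis image_iff list_decode_inverse list_encode_inverse)
    with r[of "list_decode n"] show ?thesis by (simp add: encode_word del: encode_list_def)
  qed
  then show "recursive_set (list_encode ` X)" unfolding recursive_set_def by blast
qed


section \<open>Reduced words tracing out tree paths\<close>

primrec label_path :: "('a, 'm) monoid_scheme \<Rightarrow> 'a \<Rightarrow> 'a list \<Rightarrow> ('a \<times> 'a) list" where
  "label_path G g [] = []"
| "label_path G g (a # w) = (g, a) # label_path G (g \<otimes>\<^bsub>G\<^esub> a) w"

text \<open>
  A word is reduced iff the path it labels never turns back along the edge just traversed. This is
  free reduction, except that a letter of order two cancels against itself.
\<close>

abbreviation (in group) reduced :: "'a list \<Rightarrow> bool" where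
  "reduced \<equiv> successively (\<lambda>a b. b \<noteq> inv a)"

lemma word_value_simps [simp]:
  "word_value G [] = \<one>\<^bsub>G\<^esub>"
  "word_value G (a # w) = a \<otimes>\<^bsub>G\<^esub> word_value G w"
  by (simp_all add: word_value_def)

lemma (in group) word_value_closed [simp]:
  "set w \<subseteq> carrier G \<Longrightarrow> word_value G w \<in> carrier G"
  by (induction w) auto

lemma (in group) word_value_append:
  "set v \<subseteq> carrier G \<Longrightarrow> set w \<subseteq> carrier G
   \<Longrightarrow> word_value G (v @ w) = word_value G v \<otimes> word_value G w"
  by (induction v) (auto simp: m_assoc)

lemma (in group) label_path_append:
  "g \<in> carrier G \<Longrightarrow> set v \<subseteq> carrier G
   \<Longrightarrow> label_path G g (v @ w) = label_path G g v @ label_path G (g \<otimes> word_value G v) w"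
  by (induction v arbitrary: g) (auto simp: m_assoc)

lemma length_label_path [simp]: "length (label_path G g w) = length w"
  by (induction w arbitrary: g) auto

lemma (in group) nth_label_path:
  "g \<in> carrier G \<Longrightarrow> set w \<subseteq> carrier G \<Longrightarrow> i < length w
   \<Longrightarrow> label_path G g w ! i = (g \<otimes> word_value G (take i w), w ! i)"
proof (induction w arbitrary: g i)
  case (Cons a w)
  show ?case
  proof (cases i)
    case (Suc j)
    with Cons have "label_path G g (a # w) ! i = (g \<otimes> a \<otimes> word_value G (take j w), w ! j)"
      by simp
    moreover have "set (take j w) \<subseteq> carrier G"
      using Cons.prems(2) set_take_subset[of j w] by auto
    ultimately show ?thesis using Suc Cons.prems by (simp add: m_assoc)
  qed (use Cons.prems in simp)
qed simp

locale flow_on_tree = group G for G :: "('a, 'm) monoid_scheme" (structure) +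
  fixes A :: "'a set" and T :: "('a, 'a \<times> 'a) pre_digraph"
    and \<Phi> :: "'a \<times> 'a \<Rightarrow> ('a \<times> 'a) list"
  assumes generating: "finite_symmetric_generating_set G A"
    and maximal: "maximal_tree G A T"
    and flow: "flow_function G A T \<Phi>"
begin

lemma letters_closed: "A \<subseteq> carrier G"
  and inv_letter: "a \<in> A \<Longrightarrow> inv a \<in> A"
  and finite_letters: "finite A"
  using generating unfolding finite_symmetric_generating_set_def by auto

lemma word_closed: "set w \<subseteq> A \<Longrightarrow> set w \<subseteq> carrier G"
  using letters_closed by blast

lemma tree_tail: "tail T = fst"
  and tree_head: "head T = (\<lambda>(g, a). g \<otimes> a)"
  and wf_tree: "wf_digraph T"
  and tree_acyclic: "pre_digraph.cycle T p \<Longrightarrow> \<not> distinct (map (underlying_edge G) p)"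
  using maximal
  unfolding maximal_tree_def pre_digraph.max_subgraph_def subgraph_def compatible_def
    undirected_tree_def cayley_graph_def
  by auto

lemma tree_cas_label_path:
  "g \<in> carrier G \<Longrightarrow> set w \<subseteq> carrier G
   \<Longrightarrow> pre_digraph.cas T g (label_path G g w) (g \<otimes> word_value G w)"
  by (induction w arbitrary: g)
     (auto simp: pre_digraph.cas.simps tree_tail tree_head m_assoc[symmetric])

text \<open>
  In a shortest counterexample no vertex repeats before the end, since the piece between two visits
  would be a shorter one. Hence the path is a directed cycle with distinct edges. Two of these with
  the same underlying edge would be inverse to each other, and as vertices do not repeat they would
  have to be consecutive, which reducedness excludes. So the tree would contain a cycle.
\<close>

lemma reduced_closed_tree_path_trivial:
  assumes "g \<in> carrier G" "set w \<subseteq> A" "set (label_path G g w) \<subseteq> arcs T" "reduced w"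
    and "word_value G w = \<one>"
  shows "w = []"
  using assms
proof (induction w arbitrary: g rule: length_induct)
  case (1 w)
  note g = 1(2) and w = 1(3) and path = 1(4) and red = 1(5) and closed = 1(6)
  let ?n = "length w"
  let ?v = "\<lambda>i. g \<otimes> word_value G (take i w)"
  let ?p = "label_path G g w"
  note wc = word_closed[OF w]
  have tc: "set (take i w) \<subseteq> carrier G" and dc: "set (drop i w) \<subseteq> carrier G" for i
    using wc set_take_subset[of i w] set_drop_subset[of i w] by blast+
  show "w = []"
  proof (rule ccontr)
    assume ne: "w \<noteq> []"
    \<comment> \<open>The pair of the first and the last vertex is the only one excluded: these two coincide.\<close>
    have simple: "?v i \<noteq> ?v j" if ij: "i < j" "j \<le> ?n" "j - i < ?n" for i j
    proof
      assume eq: "?v i = ?v j"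
      define x where "x = take (j - i) (drop i w)"
      define z where "z = drop j w"
      have wx: "w = take i w @ x @ z" and jx: "take j w = take i w @ x"
        using ij take_add[of i "j - i" w] append_take_drop_id[of j w] unfolding x_def z_def by auto
      have xA: "set x \<subseteq> A" using w wx by (metis Un_subset_iff set_append)
      then have xc: "set x \<subseteq> carrier G" by (rule word_closed)
      have "word_value G (take i w) \<otimes> word_value G x = word_value G (take i w) \<otimes> \<one>"
        using eq jx g tc xc by (simp add: word_value_append)
      then have "word_value G x = \<one>"
        using tc xc by simp
      moreover have "length x < ?n" "x \<noteq> []" using ij unfolding x_def by auto
      moreover have "reduced x" using red wx by (metis successively_append_iff)
      moreover have "?p = label_path G g (take i w) @ label_path G (?v i) (x @ z)"
        using wx label_path_append[OF g tc] by metis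
      then have "set (label_path G (?v i) x) \<subseteq> arcs T"
        using path label_path_append[of "?v i" x z] g tc xc by auto
      moreover have "?v i \<in> carrier G" using g tc by simp
      ultimately show False using 1(1) xA by blast
    qed
    have nth: "?p ! i = (?v i, w ! i)" if "i < ?n" for i
      using nth_label_path[OF g wc that] .
    have head_nth: "head T (?p ! i) = ?v (Suc i)" if "i < ?n" for i
    proof -
      have "w ! i \<in> carrier G" using that wc by auto
      then show ?thesis
        using that g tc wc
        by (simp add: nth tree_head take_Suc_conv_app_nth word_value_append m_assoc)
    qed
    have cas: "pre_digraph.cas T g ?p g"
      using tree_cas_label_path[OF g wc] closed g by simp
    have "distinct (map (head T) ?p)"
      unfolding distinct_conv_nth
    proof (intro allI impI)
      fix i j assume ij: "i < length (map (head T) ?p)" "j < length (map (head T) ?p)" "i \<noteq> j"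
      show "map (head T) ?p ! i \<noteq> map (head T) ?p ! j"
        using ij simple[of "Suc i" "Suc j"] simple[of "Suc j" "Suc i"]
        by (cases "i < j") (auto simp: head_nth less_imp_diff_less)
    qed
    moreover have "g \<in> verts T"
    proof -
      have "?p ! 0 \<in> arcs T"
        using path ne by (metis length_greater_0_conv length_label_path nth_mem subset_code(1))
      then have "fst (?p ! 0) \<in> verts T"
        using wf_tree wf_digraph.tail_in_verts tree_tail by metis
      with nth[of 0] ne g show ?thesis by simp
    qed
    moreover have "?p \<noteq> []" using ne by (cases w) auto
    ultimately have "pre_digraph.cycle T ?p"
      unfolding pre_digraph.cycle_def pre_digraph.awalk_def
      using path cas by (intro exI[of _ g]) (simp add: pre_digraph.awalk_verts_conv'[OF cas])
    moreover have "distinct (map (underlying_edge G) ?p)"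
    proof -
      have "underlying_edge G (?p ! i) \<noteq> underlying_edge G (?p ! j)" if ij: "i < j" "j < ?n" for i j
      proof
        assume "underlying_edge G (?p ! i) = underlying_edge G (?p ! j)"
        then consider "?p ! j = ?p ! i" | "?p ! j = edge_inv G (?p ! i)"
          unfolding underlying_edge_def by blast
        then show False
        proof cases
          case 1
          with nth ij simple[of i j] show False by (simp add: less_imp_diff_less)
        next
          case 2
          with ij have ends: "?v j = ?v i \<otimes> w ! i" and inverse: "w ! j = inv (w ! i)"
            by (simp_all add: nth edge_inv_def)
          have "?v j = ?v (Suc i)"
            using ends head_nth[of i] nth[of i] ij by (simp add: tree_head)
          then have j: "j = Suc i" using simple[of "Suc i" j] ij by fastforce
          have "w = take i w @ w ! i # w ! j # drop (Suc j) w"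
            using ij j by (simp add: Cons_nth_drop_Suc)
          then have "reduced (take i w @ w ! i # w ! j # drop (Suc j) w)" using red by simp
          then show False using inverse by (simp add: successively_append_iff)
        qed
      qed
      then show ?thesis
        unfolding distinct_conv_nth by (metis length_label_path length_map linorder_neqE_nat nth_map)
    qed
    ultimately show False using tree_acyclic by blast
  qed
qed

end


section \<open>The rewriting machine\<close>

text \<open>
  A state consists of the stack, with its top first, and the remaining input. Here \<open>i\<close> gives
  inverse letters and \<open>F u a\<close> the label of the flow path of the edge labelled \<open>a\<close> at the end of the
  path of \<open>u\<close>. The letter type is arbitrary because the machine is analysed over the generators
  themselves, while computability refers to the numbers that encode them.
\<close>

definition rewrite_step ::
    "('l \<Rightarrow> 'l) \<Rightarrow> ('l list \<Rightarrow> 'l \<Rightarrow> 'l list) \<Rightarrow> 'l list \<times> 'l list \<Rightarrow> 'l list \<times> 'l list" where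
  "rewrite_step i F p =
     (if snd p = [] then p
      else if fst p \<noteq> [] \<and> hd (fst p) = i (hd (snd p)) then (tl (fst p), tl (snd p))
      else if F (rev (fst p)) (hd (snd p)) = [hd (snd p)] then (hd (snd p) # fst p, tl (snd p))
      else (fst p, F (rev (fst p)) (hd (snd p)) @ tl (snd p)))"

lemma rewrite_step_Nil [simp]: "rewrite_step i F (u, []) = (u, [])"
  and rewrite_step_Cons: "rewrite_step i F (u, a # t) =
    (if u \<noteq> [] \<and> hd u = i a then (tl u, t)
     else if F (rev u) a = [a] then (a # u, t) else (u, F (rev u) a @ t))"
  by (simp_all add: rewrite_step_def)

definition run ::
    "('l \<Rightarrow> 'l) \<Rightarrow> ('l list \<Rightarrow> 'l \<Rightarrow> 'l list) \<Rightarrow> 'l list \<Rightarrow> 'l list \<times> 'l list" where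
  "run i F w =
     (rewrite_step i F ^^ (LEAST n. snd ((rewrite_step i F ^^ n) ([], w)) = [])) ([], w)"

text \<open>
  States without remaining input are fixed, so every halting time yields the same outcome as the
  least one.
\<close>

lemma run_eqI:
  assumes "(rewrite_step i F ^^ n) ([], w) = (u, [])"
  shows "run i F w = (u, [])"
proof -
  let ?s = "\<lambda>n. (rewrite_step i F ^^ n) ([], w)"
  define m where "m = (LEAST n. snd (?s n) = [])"
  have "snd (?s m) = []"
    unfolding m_def by (rule LeastI[of "\<lambda>n. snd (?s n) = []" n]) (simp add: assms)
  then obtain v where v: "?s m = (v, [])" by (cases "?s m") auto
  then have stays: "?s (m + k) = (v, [])" for k by (induction k) simp_all
  have "m \<le> n" unfolding m_def by (rule Least_le) (simp add: assms)
  then have "?s n = (v, [])" using stays[of "n - m"] by simp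
  with v assms show ?thesis unfolding run_def m_def by simp
qed

lemma computable_rewrite_step:
  fixes i :: "'l::coded \<Rightarrow> 'l"
  assumes "computable i" "computable (\<lambda>p. F (fst p) (snd p))"
  shows "computable (rewrite_step i F)"
proof -
  have "computable (\<lambda>p. rewrite_step i F p)"
    unfolding rewrite_step_def
    by (intro computable_intros computable_compose[OF assms(1)] computable_curried[OF assms(2)])
  then show ?thesis by simp
qed

lemma computable_run:
  fixes i :: "'l::coded \<Rightarrow> 'l"
  assumes "computable i" "computable (\<lambda>p. F (fst p) (snd p))" "computable f"
    and halts: "\<And>x. \<exists>n. snd ((rewrite_step i F ^^ n) ([], f x)) = []"
  shows "computable (\<lambda>x. run i F (f x))"
  unfolding run_def
  by (intro computable_funpow computable_rewrite_step computable_LEAST computable_intros assms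
      computable_compose[OF assms(3)])

text \<open>
  An injective renaming of the letters commutes with the moves; injectivity makes the two tests of
  the machine give the same answers before and after renaming.
\<close>

lemma rewrite_step_map:
  assumes inj: "inj_on c A"
    and i: "\<And>a. a \<in> A \<Longrightarrow> i a \<in> A \<and> j (c a) = c (i a)"
    and F: "\<And>u a. set u \<subseteq> A \<Longrightarrow> a \<in> A \<Longrightarrow> set (F u a) \<subseteq> A \<and> H (map c u) (c a) = map c (F u a)"
    and ut: "set u \<subseteq> A" "set t \<subseteq> A"
  shows "rewrite_step j H (map c u, map c t) =
      map_prod (map c) (map c) (rewrite_step i F (u, t))"
    and "set (fst (rewrite_step i F (u, t))) \<subseteq> A \<and> set (snd (rewrite_step i F (u, t))) \<subseteq> A"
proof -
  have "rewrite_step j H (map c u, map c t) =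
        map_prod (map c) (map c) (rewrite_step i F (u, t)) \<and>
      set (fst (rewrite_step i F (u, t))) \<subseteq> A \<and> set (snd (rewrite_step i F (u, t))) \<subseteq> A"
  proof (cases t)
    case (Cons a t')
    with ut have a: "a \<in> A" and t': "set t' \<subseteq> A" by auto
    have Fa: "set (F (rev u) a) \<subseteq> A" "H (rev (map c u)) (c a) = map c (F (rev u) a)"
      using F[of "rev u" a] ut a by (auto simp: rev_map)
    have "u \<noteq> [] \<Longrightarrow> hd u \<in> A" using ut by (auto dest: hd_in_set)
    then have hd: "u \<noteq> [] \<Longrightarrow> hd (map c u) = j (c a) \<longleftrightarrow> hd u = i a"
      using i[OF a] inj by (simp add: hd_map inj_on_eq_iff)
    have single: "map c (F (rev u) a) = [c a] \<longleftrightarrow> F (rev u) a = [a]"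
      using Fa a inj by (auto simp: map_eq_Cons_conv inj_on_eq_iff)
    show ?thesis
      using Cons ut a t' Fa hd single
      by (auto simp: rewrite_step_Cons map_tl dest: list.set_sel(2))
  qed (use ut in simp)
  then show "rewrite_step j H (map c u, map c t) =
      map_prod (map c) (map c) (rewrite_step i F (u, t))"
    and "set (fst (rewrite_step i F (u, t))) \<subseteq> A \<and> set (snd (rewrite_step i F (u, t))) \<subseteq> A"
    by auto
qed

lemma funpow_rewrite_step_map:
  assumes "inj_on c A" "\<And>a. a \<in> A \<Longrightarrow> i a \<in> A \<and> j (c a) = c (i a)"
    "\<And>u a. set u \<subseteq> A \<Longrightarrow> a \<in> A \<Longrightarrow> set (F u a) \<subseteq> A \<and> H (map c u) (c a) = map c (F u a)"
    and "set u \<subseteq> A" "set t \<subseteq> A"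
  shows "(rewrite_step j H ^^ n) (map c u, map c t) =
      map_prod (map c) (map c) ((rewrite_step i F ^^ n) (u, t))"
  using assms(4,5)
proof (induction n arbitrary: u t)
  case (Suc n)
  let ?s = "rewrite_step i F (u, t)"
  note step = rewrite_step_map[where c = c and A = A and i = i and j = j and F = F and H = H,
      OF assms(1-3) Suc.prems]
  have "(rewrite_step j H ^^ n) (map c (fst ?s), map c (snd ?s)) =
      map_prod (map c) (map c) ((rewrite_step i F ^^ n) (fst ?s, snd ?s))"
    using step(2) by (intro Suc.IH) auto
  then show ?case
    using step(1) by (simp add: funpow_Suc_right map_prod_def split_beta del: funpow.simps)
qed simp


section \<open>Termination and correctness\<close>

context flow_on_tree
begin

lemma walk_eq_label_path:
  "pre_digraph.cas (cayley_graph G A) g p h \<Longrightarrow> set p \<subseteq> carrier G \<times> A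
   \<Longrightarrow> p = label_path G g (path_label p) \<and> set (path_label p) \<subseteq> A \<and>
      (g \<in> carrier G \<longrightarrow> g \<otimes> word_value G (path_label p) = h)"
proof (induction p arbitrary: g)
  case (Cons e p)
  obtain b where e: "e = (g, b)" "b \<in> A" "g \<in> carrier G"
    and p: "pre_digraph.cas (cayley_graph G A) (g \<otimes> b) p h"
    using Cons.prems by (cases e) (auto simp: pre_digraph.cas.simps cayley_graph_def)
  have IH: "p = label_path G (g \<otimes> b) (path_label p)" "set (path_label p) \<subseteq> A"
    "g \<otimes> b \<otimes> word_value G (path_label p) = h"
    using Cons.IH[OF p] Cons.prems(2) e letters_closed by auto
  have "b \<in> carrier G" "word_value G (path_label p) \<in> carrier G"
    using e IH(2) letters_closed by auto
  then show ?case using e IH by (simp add: path_label_def m_assoc)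
qed (simp add: pre_digraph.cas.simps path_label_def)

lemma
  assumes "g \<in> carrier G" "a \<in> A"
  shows flow_eq_label_path: "\<Phi> (g, a) = label_path G g (path_label (\<Phi> (g, a)))"
    and flow_label_letters: "set (path_label (\<Phi> (g, a))) \<subseteq> A"
    and flow_label_value: "word_value G (path_label (\<Phi> (g, a))) = a"
proof -
  have "pre_digraph.awalk (cayley_graph G A) g (\<Phi> (g, a)) (g \<otimes> a)"
    using flow assms unfolding flow_function_def Let_def
    by (auto simp: cayley_graph_def)
  then have *: "pre_digraph.cas (cayley_graph G A) g (\<Phi> (g, a)) (g \<otimes> a)"
    "set (\<Phi> (g, a)) \<subseteq> carrier G \<times> A"
    unfolding pre_digraph.awalk_def by (auto simp: cayley_graph_def)
  show "\<Phi> (g, a) = label_path G g (path_label (\<Phi> (g, a)))"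
    and letters: "set (path_label (\<Phi> (g, a))) \<subseteq> A"
    using walk_eq_label_path[OF *] by auto
  have "g \<otimes> word_value G (path_label (\<Phi> (g, a))) = g \<otimes> a"
    using walk_eq_label_path[OF *] assms by auto
  then show "word_value G (path_label (\<Phi> (g, a))) = a"
    using assms letters letters_closed by (auto simp: word_closed)
qed

text \<open>
  This makes membership in the tree visible in the labels of flow paths. An edge outside the tree
  cannot be its own flow path, because the flow ordering is irreflexive.
\<close>

lemma flow_label_eq_singleton_iff:
  assumes "g \<in> carrier G" "a \<in> A"
  shows "path_label (\<Phi> (g, a)) = [a] \<longleftrightarrow> (g, a) \<in> arcs T"
proof
  assume "path_label (\<Phi> (g, a)) = [a]"
  then have "\<Phi> (g, a) = [(g, a)]" using flow_eq_label_path[OF assms] by simp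
  then have "(g, a) \<notin> arcs T \<Longrightarrow> ((g, a), (g, a)) \<in> flow_less G A T \<Phi>"
    unfolding flow_less_def using assms by (intro r_into_trancl) (simp add: cayley_graph_def)
  moreover have "irrefl (flow_less G A T \<Phi>)" using flow unfolding flow_function_def by simp
  ultimately show "(g, a) \<in> arcs T" by (auto simp: irrefl_def)
next
  assume "(g, a) \<in> arcs T"
  then have "\<Phi> (g, a) = [(g, a)]"
    using flow assms unfolding flow_function_def Let_def by (simp add: cayley_graph_def)
  then show "path_label (\<Phi> (g, a)) = [a]" by (simp add: path_label_def)
qed

definition flow_word :: "'a list \<Rightarrow> 'a \<Rightarrow> 'a list" where
  "flow_word u a = path_label (\<Phi> (word_value G u, a))"

abbreviation step :: "'a list \<times> 'a list \<Rightarrow> 'a list \<times> 'a list" where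
  "step \<equiv> rewrite_step (m_inv G) flow_word"

definition tree_word :: "'a list \<Rightarrow> bool" where
  "tree_word w \<longleftrightarrow> set w \<subseteq> A \<and> set (label_path G \<one> w) \<subseteq> arcs T \<and> reduced w"

lemma tree_word_Nil: "tree_word []"
  by (simp add: tree_word_def)

lemma tree_word_snoc_iff:
  "tree_word (w @ [a]) \<longleftrightarrow> tree_word w \<and> a \<in> A \<and> (word_value G w, a) \<in> arcs T \<and>
     (w \<noteq> [] \<longrightarrow> a \<noteq> inv (last w))"
  unfolding tree_word_def
  by (auto simp: label_path_append word_closed successively_append_iff)

text \<open>
  Started with any stack representing \<open>g\<close>, the machine consumes \<open>w\<close> in front of any further input
  and leaves a stack representing \<open>h\<close>. Quantifying over stack and further input makes this relation
  compose along concatenation.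
\<close>

definition reads :: "'a \<Rightarrow> 'a \<Rightarrow> 'a list \<Rightarrow> bool" where
  "reads g h w \<longleftrightarrow>
     (\<forall>u t. tree_word (rev u) \<and> word_value G (rev u) = g \<longrightarrow>
        (\<exists>n u'. (step ^^ n) (u, w @ t) = (u', t) \<and> tree_word (rev u') \<and>
           word_value G (rev u') = h))"

lemma reads_Nil: "reads g g []"
  unfolding reads_def by (auto intro: exI[of _ 0])

lemma reads_append:
  assumes "reads g h v" "reads h k w"
  shows "reads g k (v @ w)"
  unfolding reads_def
proof (intro allI impI, elim conjE)
  fix u t assume "tree_word (rev u)" "word_value G (rev u) = g"
  then obtain n u' where n: "(step ^^ n) (u, v @ w @ t) = (u', w @ t)" "tree_word (rev u')"
    "word_value G (rev u') = h"
    using assms(1) unfolding reads_def by blast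
  then obtain m u'' where m: "(step ^^ m) (u', w @ t) = (u'', t)" "tree_word (rev u'')"
    "word_value G (rev u'') = k"
    using assms(2) unfolding reads_def by blast
  have "(step ^^ (m + n)) (u, (v @ w) @ t) = (u'', t)"
    using n(1) m(1) by (simp add: funpow_add)
  with m show "\<exists>n u'. (step ^^ n) (u, (v @ w) @ t) = (u', t) \<and> tree_word (rev u') \<and>
      word_value G (rev u') = k"
    by blast
qed

text \<open>
  Cancelling and pushing finish the letter in one move. Only an edge outside the tree leads to an
  expansion, whose completion is the assumption.
\<close>

lemma reads_letter_if_expansion:
  assumes a: "a \<in> A"
    and expansion: "(g, a) \<notin> arcs T \<Longrightarrow> reads g (g \<otimes> a) (path_label (\<Phi> (g, a)))"
  shows "reads g (g \<otimes> a) [a]"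
  unfolding reads_def
proof (intro allI impI, elim conjE)
  fix u t assume u: "tree_word (rev u)" "word_value G (rev u) = g"
  have uc: "set u \<subseteq> carrier G" using u(1) letters_closed unfolding tree_word_def by auto
  then have g: "g \<in> carrier G" using u(2) by auto
  have ac: "a \<in> carrier G" using a letters_closed by blast
  show "\<exists>n u'. (step ^^ n) (u, [a] @ t) = (u', t) \<and> tree_word (rev u') \<and>
      word_value G (rev u') = g \<otimes> a"
  proof (cases "u \<noteq> [] \<and> hd u = inv a")
    case True
    then obtain v where v: "u = inv a # v" by (cases u) auto
    have "word_value G (rev v) \<otimes> inv a = g"
      using u(2) uc ac v by (simp add: word_value_append)
    then have "word_value G (rev v) = g \<otimes> a"
      using uc ac v by (auto simp: m_assoc)
    moreover have "tree_word (rev v)" using u(1) v by (simp add: tree_word_snoc_iff)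
    moreover have "(step ^^ 1) (u, [a] @ t) = (v, t)" using v by (simp add: rewrite_step_Cons)
    ultimately show ?thesis by blast
  next
    case no_cancel: False
    show ?thesis
    proof (cases "(g, a) \<in> arcs T")
      case True
      have "a \<noteq> inv (hd u)" if "u \<noteq> []"
      proof
        assume "a = inv (hd u)"
        then have "hd u = inv a" using that uc by (cases u) auto
        with no_cancel that show False by blast
      qed
      then have "tree_word (rev (a # u))"
        using u True a by (simp add: tree_word_snoc_iff last_rev)
      moreover have "word_value G (rev (a # u)) = g \<otimes> a"
        using u(2) uc ac by (simp add: word_value_append)
      moreover have "(step ^^ 1) (u, [a] @ t) = (a # u, t)"
        using no_cancel True u(2) flow_label_eq_singleton_iff[OF g a]
        by (auto simp: rewrite_step_Cons flow_word_def)
      ultimately show ?thesis by blast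
    next
      case False
      let ?w = "path_label (\<Phi> (g, a))"
      have first: "step (u, [a] @ t) = (u, ?w @ t)"
        using no_cancel False u(2) flow_label_eq_singleton_iff[OF g a]
        by (auto simp: rewrite_step_Cons flow_word_def)
      obtain n u' where "(step ^^ n) (u, ?w @ t) = (u', t)" "tree_word (rev u')"
        "word_value G (rev u') = g \<otimes> a"
        using expansion[OF False] u unfolding reads_def by blast
      moreover from this(1) first have "(step ^^ Suc n) (u, [a] @ t) = (u', t)"
        by (simp add: funpow_Suc_right del: funpow.simps)
      ultimately show ?thesis by blast
    qed
  qed
qed

lemma reads_word_if_edges:
  "g \<in> carrier G \<Longrightarrow> set w \<subseteq> A
   \<Longrightarrow> (\<And>h b. (h, b) \<in> set (label_path G g w) \<Longrightarrow> reads h (h \<otimes> b) [b])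
   \<Longrightarrow> reads g (g \<otimes> word_value G w) w"
proof (induction w arbitrary: g)
  case Nil
  then show ?case by (simp add: reads_Nil)
next
  case (Cons b w)
  have b: "b \<in> carrier G" and w: "word_value G w \<in> carrier G"
    using Cons.prems(2) letters_closed by (auto simp: word_closed)
  have "reads g (g \<otimes> b) [b]" using Cons.prems(3) by simp
  moreover have "reads (g \<otimes> b) (g \<otimes> b \<otimes> word_value G w) w"
    using Cons.prems b by (intro Cons.IH) auto
  ultimately show ?case using reads_append[of g _ "[b]"] Cons.prems(1) b w by (simp add: m_assoc)
qed

lemma wf_flow_less: "wf (flow_less G A T \<Phi>)"
  using flow unfolding flow_function_def by simp

text \<open>
  Each edge on the flow path of \<open>e\<close> lies in the tree, where its letter is never expanded, or is smaller
  than \<open>e\<close> in the flow ordering.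
\<close>

lemma reads_letter:
  "fst e \<in> carrier G \<Longrightarrow> snd e \<in> A \<Longrightarrow> reads (fst e) (fst e \<otimes> snd e) [snd e]"
proof (induction e rule: wf_induct_rule[OF wf_flow_less])
  case (1 e)
  obtain g a where e: "e = (g, a)" "g \<in> carrier G" "a \<in> A" using 1 by (cases e) auto
  let ?w = "path_label (\<Phi> (g, a))"
  have "reads g (g \<otimes> word_value G ?w) ?w" if nt: "(g, a) \<notin> arcs T"
  proof (rule reads_word_if_edges)
    fix h b assume "(h, b) \<in> set (label_path G g ?w)"
    then have hb: "(h, b) \<in> set (\<Phi> (g, a))" using flow_eq_label_path[OF e(2,3)] by simp
    have "pre_digraph.awalk (cayley_graph G A) g (\<Phi> (g, a)) (g \<otimes> a)"
      using flow e unfolding flow_function_def Let_def by (auto simp: cayley_graph_def)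
    with hb have hbc: "h \<in> carrier G" "b \<in> A"
      unfolding pre_digraph.awalk_def by (auto simp: cayley_graph_def)
    show "reads h (h \<otimes> b) [b]"
    proof (cases "(h, b) \<in> arcs T")
      case True
      with hbc show ?thesis by (intro reads_letter_if_expansion) auto
    next
      case False
      with hb hbc nt e have "((h, b), e) \<in> flow_less G A T \<Phi>"
        unfolding flow_less_def by (intro r_into_trancl) (simp add: cayley_graph_def)
      with 1(1) hbc show ?thesis by fastforce
    qed
  qed (use e flow_label_letters in auto)
  then show ?case
    using reads_letter_if_expansion[OF e(3)] flow_label_value[OF e(2,3)] e(1) by auto
qed

theorem step_decides_word_problem:
  assumes "set w \<subseteq> A"
  obtains n u where "(step ^^ n) ([], w) = (u, [])" "u = [] \<longleftrightarrow> word_value G w = \<one>"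
proof -
  have "reads \<one> (\<one> \<otimes> word_value G w) w"
  proof (rule reads_word_if_edges)
    fix h b assume "(h, b) \<in> set (label_path G \<one> w)"
    moreover have "g \<in> carrier G \<Longrightarrow> set w \<subseteq> A \<Longrightarrow> set (label_path G g w) \<subseteq> carrier G \<times> A" for g w
      using letters_closed by (induction w arbitrary: g) auto
    ultimately show "reads h (h \<otimes> b) [b]" using reads_letter[of "(h, b)"] assms by auto
  qed (use assms in auto)
  then have "reads \<one> (word_value G w) w" using assms by (simp add: word_closed)
  then obtain n u where n: "(step ^^ n) ([], w @ []) = (u, [])" and u: "tree_word (rev u)"
    "word_value G (rev u) = word_value G w"
    using tree_word_Nil unfolding reads_def by (metis rev.simps(1) word_value_simps(1))
  have "word_value G w = \<one> \<Longrightarrow> rev u = []"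
    using u reduced_closed_tree_path_trivial[of \<one> "rev u"] unfolding tree_word_def by simp
  with u(2) have "u = [] \<longleftrightarrow> word_value G w = \<one>" by auto
  with n that show thesis by simp
qed

end


section \<open>Deciding the word problem\<close>

lemma (in group) generating_set_word:
  assumes "generate G A = carrier G" "A \<subseteq> carrier G" "\<And>a. a \<in> A \<Longrightarrow> inv a \<in> A" "g \<in> carrier G"
  shows "\<exists>v. set v \<subseteq> A \<and> word_value G v = g"
proof -
  have "g \<in> generate G A" using assms(1,4) by simp
  then show ?thesis
  proof induction
    case one
    show ?case by (intro exI[of _ "[]"]) simp
  next
    case (incl h)
    then show ?case using assms(2) by (intro exI[of _ "[h]"]) auto
  next
    case (inv h)
    then show ?case using assms(2,3) by (intro exI[of _ "[inv h]"]) auto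
  next
    case (eng h k)
    then obtain v w where "set v \<subseteq> A" "word_value G v = h" "set w \<subseteq> A" "word_value G w = k"
      by blast
    then show ?case using assms(2) by (intro exI[of _ "v @ w"]) (auto simp: word_value_append)
  qed
qed

lemma (in group) word_value_concat_map:
  assumes "\<And>b. b \<in> set w \<Longrightarrow> set (f b) \<subseteq> carrier G \<and> word_value G (f b) = b"
  shows "word_value G (concat (map f w)) = word_value G w"
  using assms
proof (induction w)
  case (Cons b w)
  have "set (concat (map f w)) \<subseteq> carrier G" using Cons.prems by fastforce
  with Cons show ?case by (simp add: word_value_append)
qed simp

lemma set_subset_image:
  assumes "set u \<subseteq> f ` A"
  shows "\<exists>w. set w \<subseteq> A \<and> u = map f w"
proof -
  have "u \<in> map f ` lists A"
    using assms by (simp add: lists_image[symmetric] in_lists_conv_set subset_iff)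
  then show ?thesis by (auto simp: lists_eq_set)
qed

lemma word_code_image: "word_code A ` X = list_encode ` map (to_nat_on A) ` X"
  by (simp add: word_code_def image_image)

lemma triple_code_eq_encode:
  "triple_code A (w, a, v) =
     encode (map (to_nat_on A) w, to_nat_on A a, map (to_nat_on A) v)"
  by (simp add: triple_code_def encode_word[symmetric] word_code_def del: encode_list_def)

text \<open>
  The machine runs on numbered letters. Its two parameters are extended by default values to numbers
  that are not letters, and the translation from words over \<open>B\<close> drops such numbers, so that the
  machine halts on every list of numbers and the search for the halting time is total.
\<close>

theorem (in flow_on_tree) word_problem_recursive:
  assumes bounded: "bounded_flow G A \<Phi>"
    and recursive: "recursive_set (triple_code A ` flow_graph_set G A \<Phi>)"
    and B: "finite_symmetric_generating_set G B"
  shows "recursive_set (word_code B ` {w \<in> lists B. word_value G w = \<one>})"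
proof -
  define c where "c = to_nat_on A"
  define d where "d = from_nat_into A"
  define c' where "c' = to_nat_on B"
  define d' where "d' = from_nat_into B"
  have B_closed: "B \<subseteq> carrier G" and "finite B"
    using B unfolding finite_symmetric_generating_set_def by auto
  then have inj_c: "inj_on c A"
    and dc: "\<And>a. a \<in> A \<Longrightarrow> d (c a) = a" and dc': "\<And>b. b \<in> B \<Longrightarrow> d' (c' b) = b"
    unfolding c_def c'_def d_def d'_def
    using finite_letters by (simp_all add: countable_finite inj_on_to_nat_on)
  have dc_map: "map d (map c w) = w" if "set w \<subseteq> A" for w
    using that dc by (induction w) auto

  define j where "j n = (if n \<in> c ` A then c (inv (d n)) else 0)" for n
  have j: "inv a \<in> A \<and> j (c a) = c (inv a)" if "a \<in> A" for a
    using that dc inv_letter unfolding j_def by simp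
  have comp_j: "computable j"
  proof (rule computable_finite_support[of _ 0])
    show "finite {n. j n \<noteq> 0}"
      by (rule finite_subset[of _ "c ` A"]) (auto simp: j_def finite_letters)
  qed

  define H where "H u n =
    (if set u \<subseteq> c ` A \<and> n \<in> c ` A then map c (flow_word (map d u) (d n)) else [])" for u n
  have flow_word_letters: "set (flow_word u a) \<subseteq> A" if "set u \<subseteq> A" "a \<in> A" for u a
    using that flow_label_letters unfolding flow_word_def by (simp add: word_closed)
  have H: "set (flow_word u a) \<subseteq> A \<and> H (map c u) (c a) = map c (flow_word u a)"
    if "set u \<subseteq> A" "a \<in> A" for u a
    using that flow_word_letters[OF that] dc dc_map unfolding H_def by auto
  \<comment> \<open>On valid arguments the graph of \<open>H\<close> is the given recursive set, codes being injective.\<close>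
  have graph_H: "encode (u, n, y) \<in> triple_code A ` flow_graph_set G A \<Phi> \<longleftrightarrow>
      set u \<subseteq> c ` A \<and> n \<in> c ` A \<and> H u n = y" (is "?L \<longleftrightarrow> ?R") for u n y
  proof
    assume ?L
    then obtain w a where wa: "w \<in> lists A" "a \<in> A"
      "encode (u, n, y) = triple_code A (w, a, flow_word w a)"
      unfolding flow_graph_set_def flow_word_def by blast
    then have "(u, n, y) = (map c w, c a, map c (flow_word w a))"
      unfolding triple_code_eq_encode c_def by (simp only: encode_eq_iff)
    with wa H[of w a] show ?R by auto
  next
    assume R: ?R
    then obtain a where a: "a \<in> A" "n = c a" by blast
    from R obtain w where w: "set w \<subseteq> A" "u = map c w"
      using set_subset_image by blast
    have "(w, a, flow_word w a) \<in> flow_graph_set G A \<Phi>"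
      unfolding flow_graph_set_def flow_word_def using w a by blast
    moreover have "encode (u, n, y) = triple_code A (w, a, flow_word w a)"
      using R a w H[OF w(1) a(1)]
      by (simp only: triple_code_eq_encode c_def[symmetric])
    ultimately show ?L by blast
  qed
  have comp_H: "computable (\<lambda>p. H (fst p) (snd p))"
  proof -
    obtain k where k: "\<And>e. e \<in> arcs (cayley_graph G A) \<Longrightarrow> length (\<Phi> e) \<le> k"
      using bounded unfolding bounded_flow_def by blast
    \<comment> \<open>The empty word is the default value of \<open>H\<close>, also on invalid arguments, and is thus left out.\<close>
    let ?Y = "{y. set y \<subseteq> c ` A \<and> length y \<le> k} - {[]}"
    have short: "length (flow_word u a) \<le> k" if "set u \<subseteq> A" "a \<in> A" for u a
      using that k unfolding flow_word_def path_label_def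
      by (simp add: cayley_graph_def word_closed)
    have range: "H u n \<in> ?Y \<or> H u n = []" for u n
    proof (cases "set u \<subseteq> c ` A \<and> n \<in> c ` A")
      case True
      then obtain a where a: "a \<in> A" "n = c a" by blast
      from True obtain w where w: "set w \<subseteq> A" "u = map c w"
        using set_subset_image by blast
      show ?thesis
        using H[OF w(1) a(1)] short[OF w(1) a(1)] a w by auto
    next
      case False
      then have "H u n = []" unfolding H_def by (rule if_not_P)
      then show ?thesis ..
    qed
    show ?thesis
    proof (rule computable_finite_values)
      show "finite ?Y" using finite_letters by (simp add: finite_lists_length_le)
      show "H (fst p) (snd p) = []" if "H (fst p) (snd p) \<notin> ?Y" for p
        using range that by blast
      fix y assume "y \<in> ?Y"
      then have "(H (fst p) (snd p) = y) =
          (encode (fst p, snd p, y) \<in> triple_code A ` flow_graph_set G A \<Phi>)" for p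
        unfolding graph_H by (auto simp: H_def)
      moreover have "computable (\<lambda>p :: nat list \<times> nat.
          encode (fst p, snd p, y) \<in> triple_code A ` flow_graph_set G A \<Phi>)"
        by (intro computable_compose[OF recursive_set_imp_computable[OF recursive]]
            computable_intros)
      ultimately show "computable (\<lambda>p. H (fst p) (snd p) = y)" by (simp only:)
    qed
  qed

  obtain h where h: "\<And>b. b \<in> carrier G \<Longrightarrow> set (h b) \<subseteq> A \<and> word_value G (h b) = b"
    using generating_set_word[of A] generating unfolding finite_symmetric_generating_set_def
    by metis
  define K where "K n = (if n \<in> c' ` B then h (d' n) else [])" for n
  define f where "f w = concat (map (\<lambda>n. map c (K n)) w)" for w
  have f_eq: "f w = map c (concat (map K w))" for w
    unfolding f_def by (simp add: map_concat comp_def)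
  have K_code: "K (c' b) = h b" if "b \<in> B" for b
    using that dc' unfolding K_def by simp
  have "set (K n) \<subseteq> A" for n
  proof (cases "n \<in> c' ` B")
    case True
    then obtain b where "b \<in> B" "n = c' b" by blast
    with K_code B_closed h[of b] show ?thesis by auto
  next
    case False
    then show ?thesis unfolding K_def by simp
  qed
  then have K_letters: "set (concat (map K w)) \<subseteq> A" for w by auto
  have comp_f: "computable f"
    unfolding f_def
  proof (intro computable_concat_map computable_id computable_finite_support[of _ "[]"])
    show "finite {n. map c (K n) \<noteq> []}"
      by (rule finite_subset[of _ "c' ` B"]) (auto simp: K_def \<open>finite B\<close>)
  qed

  \<comment> \<open>The input consists of letters even if \<open>w\<close> does not, so the result over the generators applies.\<close>
  have outcome: "\<exists>n u. (rewrite_step j H ^^ n) ([], f w) = (u, []) \<and>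
      (u = [] \<longleftrightarrow> word_value G (concat (map K w)) = \<one>)" for w
  proof -
    obtain n u where n: "(step ^^ n) ([], concat (map K w)) = (u, [])"
      and u: "u = [] \<longleftrightarrow> word_value G (concat (map K w)) = \<one>"
      using step_decides_word_problem[OF K_letters] by blast
    have "(rewrite_step j H ^^ n) (map c [], map c (concat (map K w))) =
        map_prod (map c) (map c) ((step ^^ n) ([], concat (map K w)))"
      by (rule funpow_rewrite_step_map[OF inj_c]) (use j H K_letters in auto)
    with n u show ?thesis by (auto simp: f_eq)
  qed
  have halts: "\<exists>n. snd ((rewrite_step j H ^^ n) ([], f w)) = []" for w
    using outcome[of w] by (metis snd_conv)
  have result: "fst (run j H (f w)) = [] \<longleftrightarrow> word_value G (concat (map K w)) = \<one>" for w
  proof -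
    obtain n u where "(rewrite_step j H ^^ n) ([], f w) = (u, [])"
      and u: "u = [] \<longleftrightarrow> word_value G (concat (map K w)) = \<one>"
      using outcome[of w] by blast
    from this(1) have "run j H (f w) = (u, [])" by (rule run_eqI)
    with u show ?thesis by simp
  qed

  let ?X = "map c' ` {w \<in> lists B. word_value G w = \<one>}"
  have "w \<in> ?X \<longleftrightarrow> list_all (\<lambda>n. n \<in> c' ` B) w \<and> fst (run j H (f w)) = []" for w
  proof -
    have "word_value G (concat (map K w)) = word_value G v" if "set v \<subseteq> B" "w = map c' v" for v
    proof -
      have "map K w = map h v" using that K_code by auto
      then show ?thesis
        using that h B_closed letters_closed
        by (simp only:) (rule word_value_concat_map, blast)
    qed
    then have "word_value G (concat (map K w)) = \<one> \<longleftrightarrow> word_value G v = \<one>"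
      if "set v \<subseteq> B" "w = map c' v" for v
      using that by simp
    moreover have "list_all (\<lambda>n. n \<in> c' ` B) w \<longleftrightarrow> (\<exists>v. set v \<subseteq> B \<and> w = map c' v)"
      using set_subset_image[of w c' B] unfolding list_all_iff subset_eq[symmetric]
      by (metis image_mono set_map)
    moreover have "w \<in> ?X \<longleftrightarrow> (\<exists>v. set v \<subseteq> B \<and> w = map c' v \<and> word_value G v = \<one>)"
      by (auto simp: in_lists_conv_set subset_iff)
    ultimately show ?thesis unfolding result by blast
  qed
  moreover have "computable (\<lambda>w. list_all (\<lambda>n. n \<in> c' ` B) w \<and> fst (run j H (f w)) = [])"
  proof (intro computable_intros computable_list_all computable_run comp_j comp_H comp_f halts)
    show "computable (\<lambda>n. n \<in> c' ` B)"
      by (rule computable_finite_support[of _ False]) (simp add: \<open>finite B\<close>)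
  qed
  ultimately have "computable (\<lambda>w. w \<in> ?X)" by (simp only:)
  then show ?thesis
    unfolding word_code_image c'_def[symmetric] recursive_set_words_iff .
qed

theorem theorem3p3:
  fixes G :: "('a, 'm) monoid_scheme"
  assumes "group G"
    and "algorithmically_stackable G"
  shows "solvable_word_problem G"
proof -
  obtain A T \<Phi> where *: "finite_symmetric_generating_set G A" "maximal_tree G A T"
    "flow_function G A T \<Phi>" "bounded_flow G A \<Phi>"
    "recursive_set (triple_code A ` flow_graph_set G A \<Phi>)"
    using assms(2) unfolding algorithmically_stackable_def by blast
  interpret group G by (rule assms(1))
  interpret flow_on_tree G A T \<Phi> by unfold_locales (rule *)+
  show ?thesis
    unfolding solvable_word_problem_def using * word_problem_recursive by blast
qed

end
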